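(* Let $m, n$ be positive integers and $k$ an integer with $k \geq f_{n-2}(m) + 1$. Put $f_h = f_h(m)$, $$s = (-1)^n f_n f_{n-1} + k f_{n+1}, \quad t = (-1)^{n-1} f_{n-1}^2 - k f_n, \quad D = s^2 - 4t, \quad T_n = f_{n+1} s + 2 f_n.$$ Then the minimal solution of the Pell equation $X^2 - DY^2 = 1$ is: (a) $(2x^2+1, 2xy)$ if $n$ is even and $k$ is odd, where $(x,y)$ is given by: $x = \frac{(T_n^2+3)T_n}{2}$, $y = \frac{(T_n^2+1)f_{n+1}}{2}$ if $m$ is even, or if $m$ is odd and $n \equiv 0,4 \pmod 6$; and $x = \frac{T_n}{2}$, $y = \frac{f_{n+1}}{2}$ if $m$ is odd and $n \equiv 2 \pmod 6$; (b) $\left(\frac{T_n}{2}, \frac{f_{n+1}}{2}\right)$ if $n$ is odd and either $m$ is even, or $m$ is odd and $n \equiv 2 \pmod 3$; (c) $\left(\frac{T_n^3 - 3T_n}{2}, \frac{(T_n^2-1) f_{n+1}}{2}\right)$ if $n$ is odd, $m$ is odd and $n \equiv 0, 1 \pmod 3$.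
   Context: The Fibonacci polynomials $f_h(m)$, for a fixed integer $m$, are defined by $f_0(m) = 0$, $f_1(m) = 1$, $f_h(m) = m f_{h-1}(m) + f_{h-2}(m)$ for $h \geq 2$, and $f_{-h}(m) = (-1)^{h-1} f_h(m)$ for $h \geq 1$. The minimal solution of $X^2 - DY^2 = c$ is its solution in positive integers $(x,y)$ with $x+y\sqrt D$ smallest.
   Formalization: In (c) the hypothesis that k is odd is added; for even k the claimed pair is never integral (e.g. m = n = 1, k = 2 gives D = 12 and the pair (26, 15/2), while the minimal solution is (7, 2)). *)

theory Defs
  imports Complex_Main
begin

fun fib_poly_nat :: "int \<Rightarrow> nat \<Rightarrow> int" where
  "fib_poly_nat m 0 = 0"
| "fib_poly_nat m (Suc 0) = 1"
| "fib_poly_nat m (Suc (Suc h)) = m * fib_poly_nat m (Suc h) + fib_poly_nat m h"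

text \<open>For \<open>h < 0\<close>, write \<open>h = -j\<close> with \<open>j \<ge> 1\<close>; then \<open>f\<^bsub>-j\<^esub> = (-1)^(j-1) f\<^bsub>j\<^esub>\<close>.\<close>

definition fib_poly :: "int \<Rightarrow> int \<Rightarrow> int" where
  "fib_poly m h =
     (if h \<ge> 0 then fib_poly_nat m (nat h)
      else (-1) ^ nat (- h - 1) * fib_poly_nat m (nat (- h)))"

text \<open>Solutions are pairs of reals that are required to be positive integers.  The formulas
  for them involve division by 2, so the integrality of these quotients has to be part of
  being a solution; \<open>div\<close> on \<open>int\<close> would round instead.\<close>

definition pell_solutions :: "int \<Rightarrow> int \<Rightarrow> (real \<times> real) set" where
  "pell_solutions D c =
     {(x, y). x \<in> \<int> \<and> y \<in> \<int> \<and> 0 < x \<and> 0 < y \<and> x\<^sup>2 - of_int D * y\<^sup>2 = of_int c}"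

definition is_minimal_pell_solution :: "int \<Rightarrow> int \<Rightarrow> real \<times> real \<Rightarrow> bool" where
  "is_minimal_pell_solution D c p \<longleftrightarrow>
     p \<in> pell_solutions D c \<and>
     (\<forall>q \<in> pell_solutions D c. fst p + snd p * sqrt (of_int D) \<le> fst q + snd q * sqrt (of_int D))"

end

theory Submission
  imports Defs
begin

text \<open>
  By Cassini's identity \<open>T\<^sup>2 - D f\<^bsub>n+1\<^esub>\<^sup>2 = 4 c\<close> with \<open>c = (-1)^(n+1)\<close>, so
  \<open>e = (T + f\<^bsub>n+1\<^esub> sqrt D) / 2\<close> is a unit of norm \<open>c\<close>. The bound on \<open>k\<close> gives
  \<open>D > f\<^bsub>n+1\<^esub>\<^sup>2 + 4\<close>, so a unit \<open>(u + v sqrt D) / 2 > 1\<close> has \<open>u > f\<^bsub>n+1\<^esub>\<close>, and a nontrivial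
  factorisation of \<open>e\<close> would make its second coordinate exceed \<open>f\<^bsub>n+1\<^esub>\<close>. Hence \<open>e\<close> is
  fundamental, and the minimal solution is the least power of \<open>e\<close> that has norm 1 and integral
  coordinates. If \<open>f\<^bsub>n+1\<^esub>\<close> is even then \<open>e\<close> itself is integral; if it is odd (and \<open>k\<close> is odd)
  then exactly the powers of \<open>e\<^sup>3\<close> are. For even \<open>n\<close> the norm of \<open>e\<close> is -1 and the exponent must
  be even as well, which yields the exponents 6, 2, 1 and 3 in the four cases.
\<close>

section \<open>Arithmetic of the elements \<open>(u + v * sqrt D) / 2\<close>\<close>

text \<open>\<open>c\<close> is the norm of \<open>z\<close>. The real value is carried along so
  that units can be compared by size. No parity condition on \<open>u\<close> and \<open>v\<close>
  is stated, since the norm equation already forces \<open>u\<close> to have the parity of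
  \<open>D * v\<close>.\<close>

definition half_unit :: "int \<Rightarrow> int \<Rightarrow> int \<Rightarrow> int \<Rightarrow> real \<Rightarrow> bool" where
  "half_unit D c u v z \<longleftrightarrow> z = (of_int u + of_int v * sqrt (of_int D)) / 2 \<and> u\<^sup>2 - D * v\<^sup>2 = 4 * c"

text \<open>Writing \<open>z\<close> for the base, \<open>z^2 = t * z - c\<close>, hence
  \<open>z^3 = (t^2 - c) * z - t * c\<close>. With \<open>c = -1\<close> and \<open>c = 1\<close>
  this is the origin of the cubic formulas in (a) and (c).\<close>

lemma half_cube:
  fixes t x w d c :: real
  assumes "w * w = d" "t * t = d * (x * x) + 4 * c"
  shows "((t + x * w) / 2) ^ 3 = (t\<^sup>2 - 3 * c) * t / 2 + (t\<^sup>2 - c) * x / 2 * w"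
proof -
  have c: "c = (t * t - w * w * (x * x)) / 4" using assms by simp
  show ?thesis unfolding c by (simp add: power2_eq_square power3_eq_cube field_simps)
qed

text \<open>The norm equations give \<open>u\<close> the parity of \<open>D * v\<close> and
  \<open>u'\<close> that of \<open>D * v'\<close>, so both halvings are exact. The norm is
  multiplicative by Brahmagupta's identity.\<close>

lemma half_unit_mult:
  assumes "D \<ge> 0" "half_unit D c u v z" "half_unit D c' u' v' z'"
  shows "half_unit D (c * c') ((u * u' + D * v * v') div 2) ((u * v' + v * u') div 2) (z * z')"
proof -
  have r: "u\<^sup>2 - D * v\<^sup>2 = 4 * c" and r': "u'\<^sup>2 - D * v'\<^sup>2 = 4 * c'"
    using assms by (auto simp: half_unit_def)
  have "even (u\<^sup>2 - D * v\<^sup>2)" "even (u'\<^sup>2 - D * v'\<^sup>2)" unfolding r r' by simp_all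
  then have p: "even u \<longleftrightarrow> even D \<or> even v" "even u' \<longleftrightarrow> even D \<or> even v'" by auto
  obtain a where a: "u * u' + D * v * v' = 2 * a"
    using p by (metis even_add even_mult_iff evenE)
  obtain b where b: "u * v' + v * u' = 2 * b"
  proof (cases "even D")
    case True
    with p show ?thesis using that by (metis even_add even_mult_iff evenE)
  next
    case False
    with p show ?thesis using that by (metis even_add even_mult_iff evenE)
  qed
  have "(2 * a)\<^sup>2 - D * (2 * b)\<^sup>2 = (u\<^sup>2 - D * v\<^sup>2) * (u'\<^sup>2 - D * v'\<^sup>2)"
    unfolding a[symmetric] b[symmetric] by algebra
  then have n: "a\<^sup>2 - D * b\<^sup>2 = 4 * (c * c')" unfolding r r' by simp
  have q: "sqrt (of_int D) * sqrt (of_int D) = (of_int D :: real)" using assms(1) by simp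
  have "2 * z = of_int u + of_int v * sqrt (of_int D)" "2 * z' = of_int u' + of_int v' * sqrt (of_int D)"
    using assms(2,3) by (simp_all add: half_unit_def)
  then have "4 * (z * z') = (of_int u + of_int v * sqrt (of_int D)) * (of_int u' + of_int v' * sqrt (of_int D))"
    by algebra
  also have "\<dots> = of_int (u * u') + (sqrt (of_int D) * sqrt (of_int D)) * of_int (v * v')
      + of_int (u * v' + v * u') * sqrt (of_int D)"
    by (simp add: algebra_simps)
  also have "\<dots> = of_int (u * u' + D * v * v') + of_int (u * v' + v * u') * sqrt (of_int D)"
    unfolding q by simp
  finally have "z * z' = (of_int a + of_int b * sqrt (of_int D)) / 2"
    unfolding a b by simp
  with n show ?thesis unfolding a b by (simp add: half_unit_def)
qed

lemma half_unit_conj: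
  assumes "D \<ge> 0" "half_unit D c u v z"
  shows "z * ((of_int u - of_int v * sqrt (of_int D)) / 2) = of_int c"
proof -
  have q: "sqrt (of_int D) * sqrt (of_int D) = (of_int D :: real)" using assms(1) by simp
  have "real_of_int (u\<^sup>2 - D * v\<^sup>2) = of_int (4 * c)"
    using assms(2) by (simp add: half_unit_def)
  then have "(of_int u)\<^sup>2 - of_int D * (of_int v)\<^sup>2 = (4 * of_int c :: real)" by simp
  moreover have "2 * z = of_int u + of_int v * sqrt (of_int D)"
    using assms(2) by (simp add: half_unit_def)
  ultimately have "(2 * z) * (of_int u - of_int v * sqrt (of_int D)) = 4 * of_int c"
    using q by algebra
  then show ?thesis by simp
qed

text \<open>\<open>z\<close> times its conjugate is \<open>c\<close>, so for \<open>c\<close> equal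
  to 1 or -1 the inverse is \<open>c\<close> times the conjugate.\<close>

lemma half_unit_inverse:
  assumes "D \<ge> 0" "half_unit D c u v z" "c\<^sup>2 = 1"
  shows "half_unit D c (c * u) (- c * v) (inverse z)"
proof -
  let ?w = "(of_int (c * u) + of_int (- c * v) * sqrt (of_int D)) / 2 :: real"
  have "z * ?w = of_int c * (z * ((of_int u - of_int v * sqrt (of_int D)) / 2))"
    by (simp add: field_simps)
  also have "\<dots> = of_int (c\<^sup>2)" using half_unit_conj[OF assms(1,2)] by (simp add: power2_eq_square)
  finally have "z * ?w = 1" using assms(3) by simp
  then have "inverse z = ?w" by (rule inverse_unique)
  moreover have "(c * u)\<^sup>2 - D * (- c * v)\<^sup>2 = 4 * c"
  proof -
    have "(c * u)\<^sup>2 - D * (- c * v)\<^sup>2 = c\<^sup>2 * (u\<^sup>2 - D * v\<^sup>2)" by algebra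
    then show ?thesis using assms by (simp add: half_unit_def)
  qed
  ultimately show ?thesis by (simp add: half_unit_def)
qed

lemma abs_half_unit_conj:
  assumes "D \<ge> 0" "half_unit D c u v z" "c\<^sup>2 = 1" "z > 0"
  shows "\<bar>of_int u - of_int v * sqrt (of_int D)\<bar> = 2 / z"
proof -
  have "z * (of_int u - of_int v * sqrt (of_int D)) = 2 * of_int c"
    using half_unit_conj[OF assms(1,2)] by simp
  then have "\<bar>z\<bar> * \<bar>of_int u - of_int v * sqrt (of_int D)\<bar> = \<bar>2 * of_int c\<bar>"
    by (simp flip: abs_mult)
  moreover have "\<bar>c\<bar> = 1" using assms(3) by (auto simp: power2_eq_1_iff)
  ultimately show ?thesis using assms(4) by (auto simp: field_simps)
qed

text \<open>The doubled conjugate has absolute value \<open>2 / z < 2\<close>, while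
  \<open>u + v * sqrt D = 2 * z > 2\<close>; hence the sum and the difference of the two are
  positive.\<close>

lemma half_unit_pos:
  assumes "D > 0" "half_unit D c u v z" "c\<^sup>2 = 1" "z > 1"
  shows "u > 0" "v > 0"
proof -
  let ?d = "of_int u - of_int v * sqrt (of_int D) :: real"
  have "2 / z < 2" using assms(4) by (simp add: field_simps)
  then have d: "\<bar>?d\<bar> < 2" using abs_half_unit_conj[of D c u v z] assms by simp
  have z: "of_int u + of_int v * sqrt (of_int D) > (2 :: real)"
    using assms(2,4) by (simp add: half_unit_def)
  from d z have "of_int u > (0 :: real)" by linarith
  then show "u > 0" by simp
  from d z have "of_int v * sqrt (of_int D) > 0" by linarith
  then show "v > 0" using assms(1) by (simp add: zero_less_mult_iff)
qed

text \<open>Size takes the place of irrationality of \<open>sqrt D\<close>: both doubled conjugates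
  lie between -2 and 2, so \<open>\<bar>v - v'\<bar> * sqrt D\<close> is at most 2, whereas
  \<open>sqrt D > 2\<close>.\<close>

lemma half_unit_unique:
  assumes "D > 4" "half_unit D c u v z" "half_unit D c' u' v' z" "c\<^sup>2 = 1" "c'\<^sup>2 = 1" "z \<ge> 1"
  shows "u = u'" "v = v'" "c = c'"
proof -
  let ?d = "of_int u - of_int v * sqrt (of_int D) :: real"
  let ?d' = "of_int u' - of_int v' * sqrt (of_int D) :: real"
  have s: "sqrt (of_int D) > 2" using assms(1) by (simp add: real_less_rsqrt)
  have "2 / z \<le> 2" using assms(6) by (simp add: field_simps)
  then have d: "\<bar>?d\<bar> \<le> 2" "\<bar>?d'\<bar> \<le> 2"
    using abs_half_unit_conj[of D c u v z] abs_half_unit_conj[of D c' u' v' z] assms by simp_all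
  have e: "of_int u + of_int v * sqrt (of_int D) = of_int u' + of_int v' * sqrt (of_int D)"
    using assms(2,3) by (simp add: half_unit_def)
  have "of_int (v - v') * sqrt (of_int D) = (?d' - ?d) / 2"
    using e by (simp add: algebra_simps)
  then have "\<bar>of_int (v - v')\<bar> * sqrt (of_int D) \<le> 2"
    using d by (auto simp: abs_mult[symmetric] abs_le_iff)
  moreover have "\<bar>of_int (v - v')\<bar> * sqrt (of_int D) > 2" if "v \<noteq> v'"
  proof -
    have "\<bar>of_int (v - v')\<bar> \<ge> (1 :: real)" using that by linarith
    then have "1 * sqrt (of_int D) \<le> \<bar>of_int (v - v')\<bar> * sqrt (of_int D)"
      using assms(1) by (intro mult_right_mono) auto
    then show ?thesis using s by linarith
  qed
  ultimately show v: "v = v'" by force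
  with e show u: "u = u'" by simp
  show "c = c'" using assms(2,3) u v by (simp add: half_unit_def)
qed

section \<open>Integral solutions, and squaring a solution of norm -1\<close>

lemma pell_solutionsI:
  assumes "x\<^sup>2 - D * y\<^sup>2 = 1" "x > 0" "y > 0"
  shows "(of_int x, of_int y) \<in> pell_solutions D 1"
proof -
  have "real_of_int (x\<^sup>2 - D * y\<^sup>2) = 1" using assms(1) by simp
  with assms(2,3) show ?thesis by (simp add: pell_solutions_def)
qed

text \<open>Squaring gives first coordinate \<open>x^2 + D * y^2\<close>, which is
  \<open>2 * x^2 + 1\<close> when the norm is -1. This produces the shape of the solutions for even
  \<open>n\<close>.\<close>

lemma pell_solution_square:
  assumes "x\<^sup>2 - D * y\<^sup>2 = -1" "x > 0" "y > 0" "D \<ge> 0"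
  shows "(2 * (of_int x)\<^sup>2 + 1, 2 * of_int x * of_int y) \<in> pell_solutions D 1"
    and "2 * (of_int x)\<^sup>2 + 1 + 2 * of_int x * of_int y * sqrt (of_int D)
      = (of_int x + of_int y * sqrt (of_int D) :: real)\<^sup>2"
proof -
  have "(2 * x\<^sup>2 + 1)\<^sup>2 - D * (2 * x * y)\<^sup>2 = 1" using assms(1) by algebra
  moreover have "2 * x\<^sup>2 + 1 > 0" using zero_le_power2[of x] by linarith
  ultimately show "(2 * (of_int x)\<^sup>2 + 1, 2 * of_int x * of_int y) \<in> pell_solutions D 1"
    using pell_solutionsI[of "2 * x\<^sup>2 + 1" D "2 * x * y"] assms by simp
  have "real_of_int (x\<^sup>2 - D * y\<^sup>2) = of_int (-1)" using assms(1) by metis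
  then show "2 * (of_int x)\<^sup>2 + 1 + 2 * of_int x * of_int y * sqrt (of_int D)
      = (of_int x + of_int y * sqrt (of_int D) :: real)\<^sup>2"
    using assms(4) by (simp add: power2_eq_square algebra_simps)
qed

section \<open>The fundamental unit under a lower bound on \<open>D\<close>\<close>

locale half_unit_bound =
  fixes D T F c :: int and e :: real
  assumes e: "half_unit D c T F e" and c: "c\<^sup>2 = 1" and T_pos: "T > 0" and F_pos: "F > 0"
    and D_gt: "D > F\<^sup>2 + 4"
begin

lemma D_gt_4: "D > 4"
  using D_gt zero_le_power2[of F] by linarith

lemma e_gt_1: "e > 1"
proof -
  have "sqrt (of_int D) > 2" using D_gt_4 by (simp add: real_less_rsqrt)
  moreover have "1 * sqrt (of_int D) \<le> of_int F * sqrt (of_int D)"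
    using F_pos D_gt_4 by (intro mult_right_mono) auto
  ultimately show ?thesis using e T_pos by (simp add: half_unit_def)
qed

text \<open>Since \<open>v \<ge> 1\<close>, \<open>u^2 = D * v^2 + 4 * c' \<ge> D - 4 > F^2\<close>;
  the 4 in \<open>D_gt\<close> absorbs the case of norm -1.\<close>

lemma half_unit_fst_gt:
  assumes "half_unit D c' u v z" "c'\<^sup>2 = 1" "z > 1"
  shows "u > F"
proof -
  have pos: "u > 0" "v > 0" using half_unit_pos[OF _ assms] D_gt_4 by auto
  have "c' \<ge> -1" using assms(2) by (auto simp: power2_eq_1_iff)
  moreover have "D * v\<^sup>2 \<ge> D * 1"
    using pos D_gt_4 by (intro mult_left_mono) (simp_all add: int_one_le_iff_zero_less)
  moreover have "u\<^sup>2 = D * v\<^sup>2 + 4 * c'" using assms(1) by (simp add: half_unit_def)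
  ultimately have "u\<^sup>2 > F\<^sup>2" using D_gt by linarith
  then show ?thesis using pos by (simp add: power2_less_imp_less)
qed

text \<open>If \<open>1 < z < e\<close>, then \<open>z\<close> and \<open>e / z\<close> both have first coordinate above \<open>F\<close> and second
  coordinate at least 1, which makes the second coordinate of their product exceed \<open>F\<close>.\<close>

lemma e_minimal:
  assumes z: "half_unit D c' u v z" "c'\<^sup>2 = 1" "z > 1"
  shows "e \<le> z"
proof (rule ccontr)
  assume "\<not> e \<le> z"
  then have gt: "e * inverse z > 1" using z(3) by (simp add: field_simps)
  have D0: "D \<ge> 0" "D > 0" using D_gt_4 by auto
  obtain u' v' where w: "half_unit D (c * c') u' v' (e * inverse z)"
    using half_unit_mult[OF D0(1) e half_unit_inverse[OF D0(1) z(1,2)]] by blast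
  have cc: "(c * c')\<^sup>2 = 1" using c z(2) by (simp add: power_mult_distrib)
  have zw: "z * (e * inverse z) = e" using z(3) by simp
  have m: "half_unit D (c' * (c * c')) ((u * u' + D * v * v') div 2) ((u * v' + v * u') div 2) e"
    using half_unit_mult[OF D0(1) z(1) w] unfolding zw .
  have "(c' * (c * c'))\<^sup>2 = 1" using cc z(2) by (simp add: power_mult_distrib)
  \<comment> \<open>The product of \<open>z\<close> and \<open>e / z\<close> is \<open>e\<close>, so
    by uniqueness its computed second coordinate must be \<open>F\<close>.\<close>
  from half_unit_unique(2)[OF D_gt_4 m e this c] e_gt_1 have F: "(u * v' + v * u') div 2 = F" by simp
  have v: "v \<ge> 1" "v' \<ge> 1"
    using half_unit_pos(2)[OF D0(2) z] half_unit_pos(2)[OF D0(2) w cc gt] by auto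
  have u: "u \<ge> F + 1" "u' \<ge> F + 1"
    using half_unit_fst_gt[OF z] half_unit_fst_gt[OF w cc gt] by auto
  have "(F + 1) * 1 \<le> u * v'" "1 * (F + 1) \<le> v * u'"
    using u v F_pos by (intro mult_mono; simp)+
  then have "2 * (F + 1) div 2 \<le> (u * v' + v * u') div 2" by (intro zdiv_mono1) auto
  with F show False by simp
qed

lemma half_unit_power: "\<exists>u v. half_unit D (c ^ j) u v (e ^ j)"
proof (induction j)
  case 0
  have "half_unit D 1 2 0 1" by (simp add: half_unit_def)
  then show ?case by auto
next
  case (Suc j)
  then show ?case using half_unit_mult[OF _ e] D_gt_4 by fastforce
qed

lemma c_power: "(c ^ j)\<^sup>2 = 1"
  using c by (metis power_mult mult.commute power_one)

text \<open>Dividing \<open>z\<close> by the largest power of \<open>e\<close> not exceeding it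
  leaves a unit in \<open>[1, e)\<close>, which is 1 by \<open>e_minimal\<close>.\<close>

lemma half_unit_eq_power:
  assumes z: "half_unit D c' u v z" "c'\<^sup>2 = 1" "z \<ge> 1"
  obtains j where "z = e ^ j" "c' = c ^ j"
proof -
  define j where "j = (LEAST i. z < e ^ i)"
  obtain i where "z < e ^ i" using real_arch_pow[OF e_gt_1] by blast
  then have up: "z < e ^ j" unfolding j_def by (rule LeastI)
  \<comment> \<open>\<open>j\<close> is not 0, because \<open>e ^ 0 = 1\<close> does not exceed
    \<open>z\<close>.\<close>
  then obtain l where l: "j = Suc l" using z(3) by (cases j) auto
  have low: "e ^ l \<le> z" using not_less_Least[of l "\<lambda>i. z < e ^ i"] l j_def by auto
  have p: "e ^ l > 0" using e_gt_1 by simp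
  obtain a b where "half_unit D (c ^ l) a b (e ^ l)" using half_unit_power by blast
  from half_unit_mult[OF _ z(1) half_unit_inverse[OF _ this c_power]]
  obtain x y where w: "half_unit D (c' * c ^ l) x y (z * inverse (e ^ l))"
    using D_gt_4 by fastforce
  have "(c' * c ^ l)\<^sup>2 = 1" using z(2) c_power[of l] by (simp add: power_mult_distrib)
  from e_minimal[OF w this] have "\<not> z * inverse (e ^ l) > 1"
    using up l p by (auto simp: field_simps)
  with low p have eq: "z = e ^ l" by (auto simp: field_simps)
  obtain a b where "half_unit D (c ^ l) a b z" using half_unit_power eq by blast
  from half_unit_unique(3)[OF D_gt_4 z(1) this z(2) c_power z(3)] eq that show ?thesis by blast
qed

text \<open>Even coordinates mean that the element lies in Z[sqrt D]. The cube of \<open>e\<close>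
  does, so dividing by \<open>e ^ (3 * q)\<close> reduces the exponent to its remainder modulo 3.
  Remainders 1 and 2 are impossible, as \<open>e\<close> and \<open>e ^ 2\<close> have the odd
  second coordinates \<open>F\<close> and \<open>T * F\<close>.\<close>

lemma odd_imp_dvd_3:
  assumes odd: "odd T" "odd F" and z: "half_unit D (c ^ j) (2 * x) (2 * y) (e ^ j)"
  shows "3 dvd j"
proof -
  have D0: "D \<ge> 0" using D_gt_4 by simp
  define q r where "q = j div 3" and "r = j mod 3"
  have j: "j = r + 3 * q" by (simp add: q_def r_def)
  have sq: "T\<^sup>2 = D * F\<^sup>2 + 4 * c" using e by (simp add: half_unit_def)
  have "odd D" using odd sq by (metis dvd_mult2 even_add even_mult_iff even_numeral even_power pos2)
  have e2: "half_unit D (c * c) ((T * T + D * F * F) div 2) ((T * F + F * T) div 2) (e * e)"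
    using half_unit_mult[OF D0 e e] .
  then have e2: "half_unit D (c ^ 2) (D * F\<^sup>2 + 2 * c) (T * F) (e ^ 2)"
    using sq by (simp add: power2_eq_square mult.commute)
  have "half_unit D (c * c ^ 2) ((T * (D * F\<^sup>2 + 2 * c) + D * F * (T * F)) div 2)
      ((T * (T * F) + F * (D * F\<^sup>2 + 2 * c)) div 2) (e * e ^ 2)"
    using half_unit_mult[OF D0 e e2] .
  moreover have "T * (D * F\<^sup>2 + 2 * c) + D * F * (T * F) = 2 * (T * (D * F\<^sup>2 + c))" by algebra
  moreover have "T * (T * F) + F * (D * F\<^sup>2 + 2 * c) = 2 * (F * (D * F\<^sup>2 + 3 * c))"
    using sq by algebra
  \<comment> \<open>This second factor 2, from \<open>D * F^2\<close> and \<open>c\<close> both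
    being odd, makes the coordinates of \<open>e ^ 3\<close> even.\<close>
  moreover have "even (D * F\<^sup>2 + c)" "even (D * F\<^sup>2 + 3 * c)"
    using \<open>odd D\<close> odd c by (auto simp: power2_eq_1_iff)
  then obtain a' b' where "D * F\<^sup>2 + c = 2 * a'" "D * F\<^sup>2 + 3 * c = 2 * b'" by (blast elim: evenE)
  ultimately have "half_unit D (c * c ^ 2) (2 * (T * a')) (2 * (F * b')) (e * e ^ 2)"
    by (simp add: mult.left_commute)
  then obtain a b where e3: "half_unit D (c ^ 3) (2 * a) (2 * b) (e ^ 3)"
    by (auto simp: eval_nat_numeral)
  have ev: "\<exists>a b. half_unit D (c ^ (3 * i)) (2 * a) (2 * b) (e ^ (3 * i))" for i
  proof (induction i)
    case 0
    have "half_unit D 1 (2 * 1) (2 * 0) 1" by (simp add: half_unit_def)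
    then show ?case by (metis mult_0_right power_0)
  next
    case (Suc i)
    then obtain x y where "half_unit D (c ^ (3 * i)) (2 * x) (2 * y) (e ^ (3 * i))" by blast
    from half_unit_mult[OF D0 e3 this]
    have "half_unit D (c ^ (3 * Suc i)) (2 * (a * x + D * b * y)) (2 * (a * y + b * x)) (e ^ (3 * Suc i))"
      by (simp add: power_add algebra_simps)
    then show ?case by blast
  qed
  obtain a b where "half_unit D (c ^ (3 * q)) (2 * a) (2 * b) (e ^ (3 * q))" using ev by blast
  from half_unit_mult[OF D0 z half_unit_inverse[OF D0 this c_power]]
  have "\<exists>v. half_unit D (c ^ j * c ^ (3 * q)) (2 * (c ^ (3 * q) * (x * a - D * y * b))) (2 * v)
      (e ^ j * inverse (e ^ (3 * q)))"
    \<comment> \<open>The witness is half the second coordinate of \<open>e ^ j\<close> times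
      \<open>c ^ (3 * q)\<close> times the conjugate of \<open>e ^ (3 * q)\<close>.\<close>
    by (intro exI[of _ "c ^ (3 * q) * (y * a - x * b)"]) (simp add: algebra_simps)
  moreover have "c ^ j * c ^ (3 * q) = c ^ r" using c_power[of "3 * q"]
    by (simp add: j power_add power2_eq_square)
  moreover have "e ^ j * inverse (e ^ (3 * q)) = e ^ r" using e_gt_1 by (simp add: j power_add)
  ultimately obtain u v where r: "half_unit D (c ^ r) (2 * u) (2 * v) (e ^ r)" by auto
  have er: "e ^ r \<ge> 1" using e_gt_1 by (simp add: one_le_power)
  have "r \<noteq> 1" using half_unit_unique(2)[OF D_gt_4 r _ c_power _ er, of c T F] e c odd by auto
  moreover have "r \<noteq> 2"
  proof
    assume "r = 2"
    with e2 have "half_unit D (c ^ r) (D * F\<^sup>2 + 2 * c) (T * F) (e ^ r)" by simp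
    from half_unit_unique(2)[OF D_gt_4 r this c_power c_power er] have "T * F = 2 * v" ..
    then show False using odd by (metis dvd_triv_left even_mult_iff)
  qed
  moreover have "r < 3" by (simp add: r_def)
  ultimately have "r = 0" by linarith
  then show ?thesis by (simp add: r_def dvd_eq_mod_eq_0)
qed

text \<open>Every solution is a power \<open>e ^ i\<close> of norm 1 with even coordinates, so
  minimality becomes a comparison of exponents.\<close>

lemma is_minimal_pell_solutionI:
  assumes p: "(X, Y) \<in> pell_solutions D 1"
    and j: "X + Y * sqrt (of_int D) = e ^ j"
    and min: "\<And>i x y. \<lbrakk>i > 0; c ^ i = 1; half_unit D (c ^ i) (2 * x) (2 * y) (e ^ i)\<rbrakk> \<Longrightarrow> j \<le> i"
  shows "is_minimal_pell_solution D 1 (X, Y)"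
  unfolding is_minimal_pell_solution_def
proof (intro conjI ballI p)
  fix q assume "q \<in> pell_solutions D 1"
  then obtain x y where q: "q = (of_int x, of_int y)" "x > 0" "y > 0"
    and "(of_int x)\<^sup>2 - of_int D * (of_int y)\<^sup>2 = (1 :: real)"
    by (auto simp: pell_solutions_def elim!: Ints_cases)
  then have eq: "x\<^sup>2 - D * y\<^sup>2 = 1"
    by (metis of_int_1 of_int_diff of_int_eq_iff of_int_mult of_int_power)
  define z where "z = of_int x + of_int y * sqrt (of_int D)"
  have "of_int y * sqrt (of_int D) > 0" using q D_gt_4 by simp
  then have z1: "z > 1" using q(2) unfolding z_def by linarith
  have z: "half_unit D 1 (2 * x) (2 * y) z"
    using eq by (simp add: half_unit_def z_def power_mult_distrib field_simps)
  obtain i where i: "z = e ^ i" "1 = c ^ i"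
    by (rule half_unit_eq_power[OF z]) (use z1 in simp_all)
  \<comment> \<open>The exponent 0 is excluded by \<open>z > 1\<close>.\<close>
  have "j \<le> i" using min[of i x y] z z1 i by (cases i) auto
  then have "e ^ j \<le> e ^ i" using e_gt_1 by (simp add: power_increasing)
  then show "fst (X, Y) + snd (X, Y) * sqrt (of_int D) \<le> fst q + snd q * sqrt (of_int D)"
    using j i q by (simp add: z_def)
qed

end

section \<open>Positivity, Cassini's identity and parity of Fibonacci polynomials\<close>

lemma fib_poly_nat_pos: "m > 0 \<Longrightarrow> fib_poly_nat m (Suc p) > 0"
proof -
  assume "m > 0"
  then have "fib_poly_nat m p \<ge> 0 \<and> fib_poly_nat m (Suc p) > 0" by (induction p) (auto simp: add_pos_nonneg)
  then show ?thesis ..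
qed

lemma fib_poly_nat_cassini:
  "fib_poly_nat m p * fib_poly_nat m (Suc (Suc p)) - (fib_poly_nat m (Suc p))\<^sup>2 = (-1) ^ Suc p"
  by (induction p) (simp_all add: power2_eq_square algebra_simps)

lemma even_fib_poly_nat_even: "even m \<Longrightarrow> even (fib_poly_nat m p) \<longleftrightarrow> even p"
  by (induction m p rule: fib_poly_nat.induct) auto

text \<open>Modulo 2 the sequence is 0, 1, 1 repeated; the induction carries two consecutive
  terms.\<close>

lemma even_fib_poly_nat_odd:
  assumes "odd m"
  shows "even (fib_poly_nat m p) \<longleftrightarrow> 3 dvd p"
proof -
  have "(even (fib_poly_nat m p) \<longleftrightarrow> p mod 3 = 0) \<and> (even (fib_poly_nat m (Suc p)) \<longleftrightarrow> p mod 3 = 2)"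
    using assms by (induction p) (auto simp: mod_Suc)
  then show ?thesis by (simp add: dvd_eq_mod_eq_0)
qed

theorem theorem4p4:
  fixes m k s t D T :: int and n :: nat and f :: "int \<Rightarrow> int"
  assumes "m > 0" and "n > 0"
    and f: "f = fib_poly m"
    and "k \<ge> f (int n - 2) + 1"
    and s: "s = (-1) ^ n * f (int n) * f (int n - 1) + k * f (int n + 1)"
    and t: "t = (-1) ^ (n - 1) * (f (int n - 1))\<^sup>2 - k * f (int n)"
    and D: "D = s\<^sup>2 - 4 * t"
    and T: "T = f (int n + 1) * s + 2 * f (int n)"
  shows
    "(even n \<and> odd k \<and> (even m \<or> odd m \<and> (n mod 6 = 0 \<or> n mod 6 = 4)) \<longrightarrow>
        (let x = of_int ((T\<^sup>2 + 3) * T) / 2; y = of_int ((T\<^sup>2 + 1) * f (int n + 1)) / 2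
         in is_minimal_pell_solution D 1 (2 * x\<^sup>2 + 1, 2 * x * y))) \<and>
     (even n \<and> odd k \<and> odd m \<and> n mod 6 = 2 \<longrightarrow>
        (let x = of_int T / 2; y = of_int (f (int n + 1)) / 2
         in is_minimal_pell_solution D 1 (2 * x\<^sup>2 + 1, 2 * x * y))) \<and>
     (odd n \<and> (even m \<or> odd m \<and> n mod 3 = 2) \<longrightarrow>
        is_minimal_pell_solution D 1 (of_int T / 2, of_int (f (int n + 1)) / 2)) \<and>
     (odd n \<and> odd m \<and> (n mod 3 = 0 \<or> n mod 3 = 1) \<and> odd k \<longrightarrow>
        is_minimal_pell_solution D 1
          (of_int (T ^ 3 - 3 * T) / 2, of_int ((T\<^sup>2 - 1) * f (int n + 1)) / 2))"
proof -

  \<comment> \<open>Bounds, norm and parity for the given \<open>s\<close>, \<open>t\<close>,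
    \<open>D\<close>, \<open>T\<close>\<close>
  define a b F where "a = f (int n - 1)" and "b = f (int n)" and "F = f (int n + 1)"
  define c :: int where "c = - ((-1) ^ n)"
  obtain p where p: "n = Suc p" using \<open>n > 0\<close> gr0_implies_Suc by blast
  have "int n - 1 = int p" "int n = int (Suc p)" "int n + 1 = int (Suc (Suc p))" by (simp_all add: p)
  then have ap: "a = fib_poly_nat m p" and bp: "b = fib_poly_nat m (Suc p)"
    and Fp: "F = fib_poly_nat m (Suc (Suc p))"
    by (simp_all only: a_def b_def F_def f fib_poly_def nat_int) auto
  have Fab: "F = m * b + a" by (simp add: ap bp Fp)
  \<comment> \<open>The recurrence run backwards. For \<open>n = 1\<close> the index is -1, where
    the value is 1.\<close>
  have fm: "f (int n - 2) = b - m * a"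
    by (cases p) (simp_all add: ap bp f fib_poly_def p)
  have b1: "b \<ge> 1" using fib_poly_nat_pos[of m p] \<open>m > 0\<close> by (simp add: bp)
  have a0: "a \<ge> 0" and ba: "b - m * a \<ge> 0" and a1: "even n \<Longrightarrow> a \<ge> 1"
  proof -
    have nonneg: "fib_poly_nat m i \<ge> 0" for i
      using fib_poly_nat_pos[of m "i - 1"] \<open>m > 0\<close> by (cases i) auto
    show "a \<ge> 0" using nonneg by (simp add: ap)
    show "b - m * a \<ge> 0" using nonneg by (cases p) (simp_all add: ap bp)
    show "a \<ge> 1" if "even n"
      using that fib_poly_nat_pos[of m "p - 1"] \<open>m > 0\<close> by (cases p) (auto simp: ap p)
  qed
  have cas: "a * F - b\<^sup>2 = - c"
    using fib_poly_nat_cassini[of m p] by (simp add: ap bp Fp c_def p)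
  have c: "c\<^sup>2 = 1" by (simp add: c_def power_mult[symmetric] power2_eq_square power_add[symmetric])
  have s': "s = k * F - c * a * b" by (simp add: s c_def a_def b_def F_def)
  have t': "t = c * a\<^sup>2 - k * b" by (simp add: t c_def a_def b_def p)
  have T': "T = F * s + 2 * b" by (simp add: T F_def b_def)
  have k: "k \<ge> b - m * a + 1" using assms(4) fm by simp
  have F1: "F \<ge> 1"
    using Fab a0 b1 \<open>m > 0\<close> mult_mono[of 1 m 1 b] by simp
  have sF: "s \<ge> F"
  proof (cases "even n")
    case True
    have "1 * F \<le> k * F" using k ba F1 by (intro mult_right_mono) auto
    moreover have "a * b \<ge> 0" using a0 b1 by simp
    ultimately show ?thesis using True by (simp add: s' c_def)
  next
    case False
    have "(b - m * a + 1) * F \<le> k * F" using k F1 by (intro mult_right_mono) auto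
    \<comment> \<open>For odd \<open>n\<close> the term \<open>- a * b\<close> of \<open>s\<close>
      is negative; Cassini shows that the lower bound on \<open>k\<close> just compensates for
      it.\<close>
    moreover have "(b - m * a + 1) * F = F + a * b + m"
    proof -
      have "a * F - b\<^sup>2 = -1" using cas False by (simp add: c_def)
      then show ?thesis unfolding Fab by algebra
    qed
    ultimately show ?thesis using False \<open>m > 0\<close> by (simp add: s' c_def)
  qed
  \<comment> \<open>The value -2 makes \<open>D = s^2 - 4 * t\<close> at least
    \<open>F^2 + 8\<close>; from -1 the strict bound \<open>DF\<close> would not follow.\<close>
  have t2: "t \<le> -2"
  proof (cases "even n")
    case True
    have "1 * 1 \<le> k * b" using k ba b1 by (intro mult_mono) auto
    moreover have "a\<^sup>2 \<ge> 1" using a1[OF True] by simp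
    ultimately show ?thesis using True by (simp add: t' c_def)
  next
    case False
    have "(b - m * a + 1) * b \<le> k * b" using k b1 by (intro mult_right_mono) auto
    moreover have "(b - m * a + 1) * b = a\<^sup>2 + 1 + b"
      using cas False unfolding Fab c_def by (simp add: power2_eq_square algebra_simps)
    ultimately show ?thesis using False b1 by (simp add: t' c_def)
  qed
  have "F\<^sup>2 \<le> s\<^sup>2" using sF F1 by (intro power_mono) auto
  then have DF: "D > F\<^sup>2 + 4" using t2 D by linarith
  then have D4: "D > 4" using zero_le_power2[of F] by linarith
  have "F * s \<ge> 0" using sF F1 by simp
  then have T0: "T > 0" using T' b1 by linarith
  \<comment> \<open>The norm expands to \<open>4 * (b^2 + F * (b * s + t * F))\<close>, where the
    terms in \<open>k\<close> cancel; Cassini does the rest.\<close>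
  have nrm: "T\<^sup>2 - D * F\<^sup>2 = 4 * c"
  proof -
    have "T\<^sup>2 - D * F\<^sup>2 = 4 * (b\<^sup>2 - c * a * F * (b\<^sup>2 - a * F))"
      unfolding T' D s' t' by algebra
    also have "b\<^sup>2 - a * F = c" using cas by simp
    also have "b\<^sup>2 - c * a * F * c = b\<^sup>2 - c\<^sup>2 * a * F" by algebra
    finally show ?thesis using c cas by simp
  qed
  define e where "e = (of_int T + of_int F * sqrt (of_int D)) / 2"
  interpret half_unit_bound D T F c e
    using c T0 F1 DF nrm by unfold_locales (auto simp: half_unit_def e_def)
  have evT: "even T" if "even F" using that T' by simp
  \<comment> \<open>With \<open>F\<close> odd, \<open>a\<close> and \<open>b\<close> cannot both be
    odd by Cassini, so \<open>s\<close> has the parity of \<open>k * F\<close>. This is where odd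
    \<open>k\<close> enters.\<close>
  have odT: "odd T" if "odd F" "odd k"
  proof -
    have "even (a * b)"
    proof (rule ccontr)
      assume "odd (a * b)"
      then have "even (a * F - b\<^sup>2)" using that by simp
      then show False using cas by (simp add: c_def)
    qed
    then show ?thesis using that T' s' by auto
  qed
  have c_even: "c = -1" if "even n" using that by (simp add: c_def)
  have c_odd: "c = 1" if "odd n" using that by (simp add: c_def)
  have q: "sqrt (of_int D) * sqrt (of_int D) = (of_int D :: real)" using D4 by simp
  have nrm_real: "of_int T * of_int T = of_int D * (of_int F * of_int F) + (4 * of_int c :: real)"
  proof -
    have "T\<^sup>2 = D * F\<^sup>2 + 4 * c" using nrm by simp
    then have "real_of_int (T\<^sup>2) = of_int (D * F\<^sup>2 + 4 * c)" by (rule arg_cong)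
    then show ?thesis by (simp add: power2_eq_square)
  qed
  have e3: "e ^ 3 = of_int ((T\<^sup>2 - 3 * c) * T) / 2 + of_int ((T\<^sup>2 - c) * F) / 2 * sqrt (of_int D)"
    unfolding e_def half_cube[OF q nrm_real] by simp
  \<comment> \<open>The cube has norm \<open>c ^ 3 = c\<close>.\<close>
  have nrm3: "((T\<^sup>2 - 3 * c) * T)\<^sup>2 - D * ((T\<^sup>2 - c) * F)\<^sup>2 = 4 * c"
    using nrm c by algebra
  have min3: "3 \<le> i" if "odd F" "odd k" "i > 0" "half_unit D (c ^ i) (2 * x) (2 * y) (e ^ i)" for i x y
    using odd_imp_dvd_3[OF odT that(1) that(4)] that by (auto intro: dvd_imp_le)
  have min2: "even i" if "even n" "c ^ i = 1" for i
    using that c_even by (cases "even i") auto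
  \<comment> \<open>\<open>F\<close> has index \<open>n + 1\<close>, so for odd \<open>m\<close> it
    is even exactly when \<open>n mod 3 = 2\<close>, and for even \<open>m\<close> exactly when
    \<open>n\<close> is odd.\<close>
  have oddF: "odd F" if "even m \<and> even n \<or> odd m \<and> n mod 3 \<noteq> 2"
    using that even_fib_poly_nat_even[of m "Suc n"] even_fib_poly_nat_odd[of m "Suc n"]
    unfolding Fp p dvd_eq_mod_eq_0 by (auto simp: mod_Suc split: if_splits)
  have evenF: "even F" if "even m \<and> odd n \<or> odd m \<and> n mod 3 = 2"
    using that even_fib_poly_nat_even[of m "Suc n"] even_fib_poly_nat_odd[of m "Suc n"]
    unfolding Fp p dvd_eq_mod_eq_0 by (auto simp: mod_Suc split: if_splits)
  have m6: "n mod 3 = n mod 6 mod 3" by (simp add: mod_mod_cancel)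

  \<comment> \<open>The four cases, with exponents 6, 2, 1 and 3\<close>
  show ?thesis unfolding F_def[symmetric]
  proof (intro conjI impI; elim conjE)
    assume "even n" "odd k" and h: "even m \<or> odd m \<and> (n mod 6 = 0 \<or> n mod 6 = 4)"
    have c: "c = -1" using c_even \<open>even n\<close> .
    have F: "odd F" using oddF h \<open>even n\<close> m6 by auto
    note T = odT[OF F \<open>odd k\<close>]
    have "even ((T\<^sup>2 + 3) * T)" using T by simp
    then obtain x where x: "(T\<^sup>2 + 3) * T = 2 * x" by (rule evenE)
    have "even ((T\<^sup>2 + 1) * F)" using T by simp
    then obtain y where y: "(T\<^sup>2 + 1) * F = 2 * y" by (rule evenE)
    have "T\<^sup>2 \<ge> 0" by simp
    then have "2 * x > 0" "2 * y > 0" unfolding x[symmetric] y[symmetric] using T0 F1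
      by (simp_all add: add_nonneg_pos)
    then have pos: "x > 0" "y > 0" by simp_all
    have "(2 * x)\<^sup>2 - D * (2 * y)\<^sup>2 = -4" using nrm3 unfolding c x[symmetric] y[symmetric] by simp
    then have xy: "x\<^sup>2 - D * y\<^sup>2 = -1" by simp
    have "of_int x + of_int y * sqrt (of_int D) = e ^ 3" using e3 unfolding c by (simp add: x y)
    then have e6: "2 * (of_int x)\<^sup>2 + 1 + 2 * of_int x * of_int y * sqrt (of_int D) = e ^ 6"
      using pell_solution_square(2)[OF xy pos] D4 by (simp flip: power_mult)
    have "is_minimal_pell_solution D 1 (2 * (of_int x)\<^sup>2 + 1, 2 * of_int x * of_int y)"
    proof (rule is_minimal_pell_solutionI[OF pell_solution_square(1)[OF xy pos] e6])
      fix i x y assume i: "i > 0" "c ^ i = 1" "half_unit D (c ^ i) (2 * x) (2 * y) (e ^ i)"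
      \<comment> \<open>Integrality forces the factor 3 and norm 1 the factor 2.\<close>
      have "3 dvd i" "2 dvd i" using odd_imp_dvd_3[OF T F i(3)] min2[OF \<open>even n\<close> i(2)] by auto
      then have "6 dvd i" by presburger
      then show "6 \<le> i" using i(1) by (rule dvd_imp_le)
    qed (use D4 in simp)
    then show "let x = of_int ((T\<^sup>2 + 3) * T) / 2; y = of_int ((T\<^sup>2 + 1) * F) / 2
         in is_minimal_pell_solution D 1 (2 * x\<^sup>2 + 1, 2 * x * y)"
      unfolding x y Let_def by simp
  next
    assume "even n" "odd m" "n mod 6 = 2"
    have c: "c = -1" using c_even \<open>even n\<close> .
    have F: "even F" using evenF \<open>odd m\<close> \<open>n mod 6 = 2\<close> m6 by auto
    obtain x where x: "T = 2 * x" using evT[OF F] by (auto elim: evenE)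
    obtain y where y: "F = 2 * y" using F by (auto elim: evenE)
    have pos: "x > 0" "y > 0" using T0 F1 x y by auto
    have xy: "x\<^sup>2 - D * y\<^sup>2 = -1" using nrm unfolding c x y by simp
    have "of_int x + of_int y * sqrt (of_int D) = e" by (simp add: e_def x y add_divide_distrib)
    then have e2: "2 * (of_int x)\<^sup>2 + 1 + 2 * of_int x * of_int y * sqrt (of_int D) = e ^ 2"
      using pell_solution_square(2)[OF xy pos] D4 by simp
    have "is_minimal_pell_solution D 1 (2 * (of_int x)\<^sup>2 + 1, 2 * of_int x * of_int y)"
    proof (rule is_minimal_pell_solutionI[OF pell_solution_square(1)[OF xy pos] e2])
      fix i assume "i > 0" "c ^ i = 1"
      then show "2 \<le> i" using min2[OF \<open>even n\<close>] by (auto intro: dvd_imp_le)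
    qed (use D4 in simp)
    then show "let x = of_int T / 2; y = of_int F / 2
         in is_minimal_pell_solution D 1 (2 * x\<^sup>2 + 1, 2 * x * y)"
      unfolding x y Let_def by simp
  next
    assume "odd n" and h: "even m \<or> odd m \<and> n mod 3 = 2"
    have c: "c = 1" using c_odd \<open>odd n\<close> .
    have F: "even F" using evenF h \<open>odd n\<close> by auto
    obtain x where x: "T = 2 * x" using evT[OF F] by (auto elim: evenE)
    obtain y where y: "F = 2 * y" using F by (auto elim: evenE)
    have pos: "x > 0" "y > 0" using T0 F1 x y by auto
    have xy: "x\<^sup>2 - D * y\<^sup>2 = 1" using nrm unfolding c x y by simp
    have e1: "of_int x + of_int y * sqrt (of_int D) = e ^ 1"
      by (simp add: e_def x y add_divide_distrib)
    have "is_minimal_pell_solution D 1 (of_int x, of_int y)"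
      by (rule is_minimal_pell_solutionI[OF pell_solutionsI[OF xy pos] e1]) simp
    then show "is_minimal_pell_solution D 1 (of_int T / 2, of_int F / 2)"
      unfolding x y by simp
  next
    assume "odd n" "odd m" "odd k" and h: "n mod 3 = 0 \<or> n mod 3 = 1"
    have c: "c = 1" using c_odd \<open>odd n\<close> .
    have F: "odd F" using oddF h \<open>odd m\<close> by auto
    note T = odT[OF F \<open>odd k\<close>]
    have "even (T ^ 3 - 3 * T)" using T by simp
    then obtain x where x: "T ^ 3 - 3 * T = 2 * x" by (rule evenE)
    have "even ((T\<^sup>2 - 1) * F)" using T by simp
    then obtain y where y: "(T\<^sup>2 - 1) * F = 2 * y" by (rule evenE)
    have x': "(T\<^sup>2 - 3) * T = 2 * x" unfolding x[symmetric] by algebra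
    \<comment> \<open>Positivity of \<open>T^3 - 3 * T\<close> needs \<open>T^2 > 3\<close>, which
      holds because \<open>T^2 = D * F^2 + 4\<close>.\<close>
    have "D * 1 \<le> D * F\<^sup>2" using D4 F1 by (intro mult_left_mono) auto
    then have "T\<^sup>2 > 3" using nrm D4 c by linarith
    then have "2 * x > 0" "2 * y > 0" unfolding x'[symmetric] y[symmetric] using T0 F1 by simp_all
    then have pos: "x > 0" "y > 0" by simp_all
    have "(2 * x)\<^sup>2 - D * (2 * y)\<^sup>2 = 4" using nrm3 unfolding c x'[symmetric] y[symmetric] by simp
    then have xy: "x\<^sup>2 - D * y\<^sup>2 = 1" by simp
    have e3': "of_int x + of_int y * sqrt (of_int D) = e ^ 3" using e3 unfolding c by (simp add: x' y)
    have "is_minimal_pell_solution D 1 (of_int x, of_int y)"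
      by (rule is_minimal_pell_solutionI[OF pell_solutionsI[OF xy pos] e3'])
        (use min3 F \<open>odd k\<close> in blast)
    then show "is_minimal_pell_solution D 1
          (of_int (T ^ 3 - 3 * T) / 2, of_int ((T\<^sup>2 - 1) * F) / 2)"
      unfolding x y by simp
  qed
qed

end
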